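(* Let $(X,\mathscr A,\mu)$ be a $\sigma$-finite measure space and let $\phi$ be a nonsingular transformation of $X$. Then the following conditions are equivalent: (i) $\mathcal D(C_\phi^n)$ is dense in $L^2(\mu)$ for every $n\in\mathbb N$; (ii) $\mathcal D^\infty(C_\phi)$ is dense in $L^2(\mu)$; (iii) $\mathcal D^\infty(C_\phi)$ is a core for $C_\phi^n$ for every $n\in\mathbb Z_+$; (iv) $\mathcal D^\infty(C_\phi)$ is dense in $(\mathcal D(C_\phi^n),\|\cdot\|_{C_\phi,n})$ for every $n\in\mathbb Z_+$.
   Context: $\mathbb N=\{1,2,\dots\}$, $\mathbb Z_+=\{0,1,2,\dots\}$. $L^2(\mu)$ is the complex Hilbert space of square integrable complex functions on $X$. A transformation $\phi\colon X\to X$ is nonsingular if $\phi^{-1}(\Delta)\in\mathscr A$ for all $\Delta\in\mathscr A$ and the measure $\mu\circ\phi^{-1}$, $\Delta\mapsto\mu(\phi^{-1}(\Delta))$, is absolutely continuous with respect to $\mu$. The composition operator $C_\phi$ in $L^2(\mu)$ is given by $\mathcal D(C_\phi)=\{f\in L^2(\mu)\colon f\circ\phi\in L^2(\mu)\}$, $C_\phi f=f\circ\phi$ (possibly unbounded, not assumed densely defined). For an operator $A$, $\mathcal D(A)$ is its domain, powers $A^n$ have their natural domains ($A^0=I$), $\mathcal D^\infty(A)=\bigcap_{n=0}^\infty\mathcal D(A^n)$, and $\|f\|_{A,n}^2=\sum_{j=0}^n\|A^jf\|^2$ for $f\in\mathcal D(A^n)$. A vector subspace $\mathcal E\subseteq\mathcal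 D(A)$ is a core for $A$ if it is dense in $\mathcal D(A)$ with respect to the graph norm $(\|f\|^2+\|Af\|^2)^{1/2}$. *)

theory Defs
  imports "HOL-Analysis.Analysis"
begin

section \<open>The space of classes of square integrable complex functions\<close>

definition square_integrable :: "'a measure \<Rightarrow> ('a \<Rightarrow> complex) set" where
  "square_integrable M = {f \<in> borel_measurable M. integrable M (\<lambda>x. (cmod (f x))\<^sup>2)}"

definition ae_eq :: "'a measure \<Rightarrow> (('a \<Rightarrow> complex) \<times> ('a \<Rightarrow> complex)) set" where
  "ae_eq M = {(f, g). f \<in> square_integrable M \<and> g \<in> square_integrable M \<and> (AE x in M. f x = g x)}"

text \<open>Vectors are equivalence classes, i.e. sets of functions; the operations below are lifted
  from representatives in the usual way (the corresponding congruence facts are proved below).\<close>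

type_synonym 'a l2 = "('a \<Rightarrow> complex) set"

definition L2 :: "'a measure \<Rightarrow> 'a l2 set" where
  "L2 M = square_integrable M // ae_eq M"

definition l2_zero :: "'a measure \<Rightarrow> 'a l2" where
  "l2_zero M = ae_eq M `` {\<lambda>x. 0}"

definition l2_add :: "'a measure \<Rightarrow> 'a l2 \<Rightarrow> 'a l2 \<Rightarrow> 'a l2" where
  "l2_add M F G = (\<Union>f\<in>F. \<Union>g\<in>G. ae_eq M `` {\<lambda>x. f x + g x})"

definition l2_scale :: "'a measure \<Rightarrow> complex \<Rightarrow> 'a l2 \<Rightarrow> 'a l2" where
  "l2_scale M c F = (\<Union>f\<in>F. ae_eq M `` {\<lambda>x. c * f x})"

definition l2_diff :: "'a measure \<Rightarrow> 'a l2 \<Rightarrow> 'a l2 \<Rightarrow> 'a l2" where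
  "l2_diff M F G = l2_add M F (l2_scale M (-1) G)"

definition l2_norm :: "'a measure \<Rightarrow> 'a l2 \<Rightarrow> real" where
  "l2_norm M F = the_elem ((\<lambda>f. sqrt (\<integral>x. (cmod (f x))\<^sup>2 \<partial>M)) ` F)"

definition l2_subspace :: "'a measure \<Rightarrow> 'a l2 set \<Rightarrow> bool" where
  "l2_subspace M E \<longleftrightarrow> E \<subseteq> L2 M \<and> l2_zero M \<in> E \<and>
     (\<forall>F\<in>E. \<forall>G\<in>E. l2_add M F G \<in> E) \<and> (\<forall>c. \<forall>F\<in>E. l2_scale M c F \<in> E)"

text \<open>Density of \<open>E\<close> in \<open>D\<close> with respect to a norm \<open>N\<close> on \<open>D\<close>, which need not be the norm of
  the ambient space.\<close>

definition l2_dense :: "'a measure \<Rightarrow> ('a l2 \<Rightarrow> real) \<Rightarrow> 'a l2 set \<Rightarrow> 'a l2 set \<Rightarrow> bool" where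
  "l2_dense M N E D \<longleftrightarrow> E \<subseteq> D \<and> (\<forall>F\<in>D. \<forall>e>0. \<exists>G\<in>E. N (l2_diff M F G) < e)"


section \<open>Unbounded operators\<close>

text \<open>An operator is a partial function; its domain is \<^term>\<open>dom A\<close>. The space \<open>H\<close> enters the
  powers only as the domain of the zeroth power.\<close>

primrec op_power :: "'v set \<Rightarrow> ('v \<rightharpoonup> 'v) \<Rightarrow> nat \<Rightarrow> ('v \<rightharpoonup> 'v)" where
  "op_power H A 0 = (\<lambda>F. if F \<in> H then Some F else None)"
| "op_power H A (Suc n) = A \<circ>\<^sub>m op_power H A n"

definition dom_infinity :: "'v set \<Rightarrow> ('v \<rightharpoonup> 'v) \<Rightarrow> 'v set" where
  "dom_infinity H A = (\<Inter>n. dom (op_power H A n))"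

definition graph_norm :: "'a measure \<Rightarrow> ('a l2 \<rightharpoonup> 'a l2) \<Rightarrow> 'a l2 \<Rightarrow> real" where
  "graph_norm M A F = sqrt ((l2_norm M F)\<^sup>2 + (l2_norm M (the (A F)))\<^sup>2)"

definition power_graph_norm :: "'a measure \<Rightarrow> ('a l2 \<rightharpoonup> 'a l2) \<Rightarrow> nat \<Rightarrow> 'a l2 \<Rightarrow> real" where
  "power_graph_norm M A n F = sqrt (\<Sum>j\<le>n. (l2_norm M (the (op_power (L2 M) A j F)))\<^sup>2)"

definition is_core :: "'a measure \<Rightarrow> ('a l2 \<rightharpoonup> 'a l2) \<Rightarrow> 'a l2 set \<Rightarrow> bool" where
  "is_core M A E \<longleftrightarrow> l2_subspace M E \<and> E \<subseteq> dom A \<and> l2_dense M (graph_norm M A) E (dom A)"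


section \<open>Composition operators\<close>

definition nonsingular :: "'a measure \<Rightarrow> ('a \<Rightarrow> 'a) \<Rightarrow> bool" where
  "nonsingular M \<phi> \<longleftrightarrow> \<phi> \<in> measurable M M \<and> absolutely_continuous M (distr M M \<phi>)"

definition comp_op :: "'a measure \<Rightarrow> ('a \<Rightarrow> 'a) \<Rightarrow> 'a l2 \<rightharpoonup> 'a l2" where
  "comp_op M \<phi> F =
     (if F \<in> L2 M \<and> (\<forall>f\<in>F. f \<circ> \<phi> \<in> square_integrable M)
      then Some (\<Union>f\<in>F. ae_eq M `` {f \<circ> \<phi>}) else None)"


section \<open>The lifted operations are well defined\<close>

lemma square_integrable_add:
  assumes "f \<in> square_integrable M" "g \<in> square_integrable M"
  shows "(\<lambda>x. f x + g x) \<in> square_integrable M"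
proof -
  have m: "f \<in> borel_measurable M" "g \<in> borel_measurable M"
    and i: "integrable M (\<lambda>x. (cmod (f x))\<^sup>2)" "integrable M (\<lambda>x. (cmod (g x))\<^sup>2)"
    using assms by (auto simp: square_integrable_def)
  have b: "(cmod (a + b))\<^sup>2 \<le> 2 * (cmod a)\<^sup>2 + 2 * (cmod b)\<^sup>2" for a b
  proof -
    have "(cmod (a + b))\<^sup>2 \<le> (cmod a + cmod b)\<^sup>2"
      by (intro power_mono norm_triangle_ineq norm_ge_zero)
    also have "\<dots> \<le> 2 * (cmod a)\<^sup>2 + 2 * (cmod b)\<^sup>2"
      using sum_squares_bound[of "cmod a" "cmod b"] by (simp add: power2_sum)
    finally show ?thesis .
  qed
  have "integrable M (\<lambda>x. 2 * (cmod (f x))\<^sup>2 + 2 * (cmod (g x))\<^sup>2)"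
    using i by simp
  then have "integrable M (\<lambda>x. (cmod (f x + g x))\<^sup>2)"
    by (rule Bochner_Integration.integrable_bound) (use m b in auto)
  with m show ?thesis by (simp add: square_integrable_def)
qed

lemma square_integrable_scale:
  "f \<in> square_integrable M \<Longrightarrow> (\<lambda>x. c * f x) \<in> square_integrable M"
  by (auto simp: square_integrable_def norm_mult power_mult_distrib)

lemma equiv_ae_eq: "equiv (square_integrable M) (ae_eq M)"
proof (rule equivI)
  show "ae_eq M \<subseteq> square_integrable M \<times> square_integrable M"
    by (auto simp: ae_eq_def)
  show "refl_on (square_integrable M) (ae_eq M)"
    by (auto simp: refl_on_def ae_eq_def)
  show "sym (ae_eq M)"
    by (rule symI) (auto simp: ae_eq_def elim: AE_mp)
  show "trans (ae_eq M)"
  proof (rule transI)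
    fix f g h assume a: "(f, g) \<in> ae_eq M" "(g, h) \<in> ae_eq M"
    then have "AE x in M. f x = g x" "AE x in M. g x = h x" by (auto simp: ae_eq_def)
    then have "AE x in M. f x = h x" by eventually_elim simp
    with a show "(f, h) \<in> ae_eq M" by (auto simp: ae_eq_def)
  qed
qed

lemma congruent2_add: "congruent2 (ae_eq M) (ae_eq M) (\<lambda>f g. ae_eq M `` {\<lambda>x. f x + g x})"
proof (rule congruent2I'[of "ae_eq M" "ae_eq M"])
  fix f f' g g' assume a: "(f, f') \<in> ae_eq M" "(g, g') \<in> ae_eq M"
  then have "AE x in M. f x = f' x" "AE x in M. g x = g' x" by (auto simp: ae_eq_def)
  then have "AE x in M. f x + g x = f' x + g' x" by eventually_elim simp
  with a have "(\<lambda>x. f x + g x, \<lambda>x. f' x + g' x) \<in> ae_eq M"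
    by (auto simp: ae_eq_def intro: square_integrable_add)
  then show "ae_eq M `` {\<lambda>x. f x + g x} = ae_eq M `` {\<lambda>x. f' x + g' x}"
    by (rule equiv_class_eq[OF equiv_ae_eq])
qed

lemma congruent_scale: "congruent (ae_eq M) (\<lambda>f. ae_eq M `` {\<lambda>x. c * f x})"
proof (rule congruentI)
  fix f g assume a: "(f, g) \<in> ae_eq M"
  then have "AE x in M. f x = g x" by (auto simp: ae_eq_def)
  then have "AE x in M. c * f x = c * g x" by eventually_elim simp
  with a have "(\<lambda>x. c * f x, \<lambda>x. c * g x) \<in> ae_eq M"
    by (auto simp: ae_eq_def intro: square_integrable_scale)
  then show "ae_eq M `` {\<lambda>x. c * f x} = ae_eq M `` {\<lambda>x. c * g x}"
    by (rule equiv_class_eq[OF equiv_ae_eq])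
qed

lemma l2_add_class:
  assumes "f \<in> square_integrable M" "g \<in> square_integrable M"
  shows "l2_add M (ae_eq M `` {f}) (ae_eq M `` {g}) = ae_eq M `` {\<lambda>x. f x + g x}"
  unfolding l2_add_def
  by (rule UN_equiv_class2[OF equiv_ae_eq equiv_ae_eq congruent2_add assms])

lemma l2_scale_class:
  assumes "f \<in> square_integrable M"
  shows "l2_scale M c (ae_eq M `` {f}) = ae_eq M `` {\<lambda>x. c * f x}"
  unfolding l2_scale_def by (rule UN_equiv_class[OF equiv_ae_eq congruent_scale assms])

lemma l2_diff_class:
  assumes "f \<in> square_integrable M" "g \<in> square_integrable M"
  shows "l2_diff M (ae_eq M `` {f}) (ae_eq M `` {g}) = ae_eq M `` {\<lambda>x. f x - g x}"
  using l2_add_class[OF assms(1) square_integrable_scale[OF assms(2), of "-1"]]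
  by (simp add: l2_diff_def l2_scale_class[OF assms(2)])

lemma l2_norm_class:
  assumes "f \<in> square_integrable M"
  shows "l2_norm M (ae_eq M `` {f}) = sqrt (\<integral>x. (cmod (f x))\<^sup>2 \<partial>M)"
proof -
  let ?n = "\<lambda>f. sqrt (\<integral>x. (cmod (f x))\<^sup>2 \<partial>M)"
  have "?n g = ?n f" if "(f, g) \<in> ae_eq M" for g
  proof -
    have ae: "AE x in M. (cmod (g x))\<^sup>2 = (cmod (f x))\<^sup>2"
      using that by (auto simp: ae_eq_def elim: AE_mp)
    have "(\<integral>x. (cmod (g x))\<^sup>2 \<partial>M) = (\<integral>x. (cmod (f x))\<^sup>2 \<partial>M)"
      by (rule integral_cong_AE[OF _ _ ae])
        (use that in \<open>auto simp: ae_eq_def square_integrable_def\<close>)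
    then show ?thesis by simp
  qed
  moreover have "(f, f) \<in> ae_eq M" using assms by (auto simp: ae_eq_def)
  ultimately have "?n ` (ae_eq M `` {f}) = {?n f}" by blast
  then show ?thesis by (simp add: l2_norm_def)
qed

lemma nonsingular_AE:
  assumes "nonsingular M \<phi>" "AE x in M. P x"
  shows "AE x in M. P (\<phi> x)"
proof -
  have m: "\<phi> \<in> measurable M M" and "null_sets M \<subseteq> null_sets (distr M M \<phi>)"
    using assms(1) by (auto simp: nonsingular_def absolutely_continuous_def)
  with assms(2) have "AE x in distr M M \<phi>. P x"
    by (auto simp: eventually_ae_filter)
  then show ?thesis by (rule AE_distrD[OF m])
qed

lemma comp_op_class:
  assumes "nonsingular M \<phi>" "f \<in> square_integrable M"
  shows "comp_op M \<phi> (ae_eq M `` {f}) =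
    (if f \<circ> \<phi> \<in> square_integrable M then Some (ae_eq M `` {f \<circ> \<phi>}) else None)"
proof -
  have m: "\<phi> \<in> measurable M M" using assms(1) by (simp add: nonsingular_def)
  have ff: "(f, f) \<in> ae_eq M" using assms(2) by (auto simp: ae_eq_def)
  have L: "ae_eq M `` {f} \<in> L2 M" using assms(2) by (auto simp: L2_def intro: quotientI)
  have step: "(f \<circ> \<phi>, g \<circ> \<phi>) \<in> ae_eq M"
    if "(f, g) \<in> ae_eq M" and s: "f \<circ> \<phi> \<in> square_integrable M" for g
  proof -
    have ae: "AE x in M. f (\<phi> x) = g (\<phi> x)"
      using that nonsingular_AE[OF assms(1), of "\<lambda>x. f x = g x"] by (auto simp: ae_eq_def)
    have g: "g \<in> borel_measurable M"
      using that by (auto simp: ae_eq_def square_integrable_def)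
    have gm: "g \<circ> \<phi> \<in> borel_measurable M" by (rule measurable_comp[OF m g])
    have fm: "f \<circ> \<phi> \<in> borel_measurable M"
      and i: "integrable M (\<lambda>x. (cmod ((f \<circ> \<phi>) x))\<^sup>2)"
      using s by (auto simp: square_integrable_def)
    have "integrable M (\<lambda>x. (cmod ((g \<circ> \<phi>) x))\<^sup>2)"
    proof (rule integrable_cong_AE_imp[OF i])
      show "(\<lambda>x. (cmod ((g \<circ> \<phi>) x))\<^sup>2) \<in> borel_measurable M" using gm by measurable
      show "AE x in M. (cmod ((f \<circ> \<phi>) x))\<^sup>2 = (cmod ((g \<circ> \<phi>) x))\<^sup>2"
        using ae by eventually_elim simp
    qed
    with gm s ae show ?thesis by (auto simp: ae_eq_def square_integrable_def)
  qed
  show ?thesis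
  proof (cases "f \<circ> \<phi> \<in> square_integrable M")
    case True
    have s: "g \<circ> \<phi> \<in> square_integrable M" if "g \<in> ae_eq M `` {f}" for g
      using step[of g] that True by (auto simp: ae_eq_def)
    have "ae_eq M `` {g \<circ> \<phi>} = ae_eq M `` {f \<circ> \<phi>}" if "g \<in> ae_eq M `` {f}" for g
      using equiv_class_eq[OF equiv_ae_eq step[of g]] that True by auto
    then have "(\<Union>g\<in>ae_eq M `` {f}. ae_eq M `` {g \<circ> \<phi>}) = ae_eq M `` {f \<circ> \<phi>}"
      using ff by blast
    with True s L show ?thesis by (simp add: comp_op_def)
  next
    case False
    with ff show ?thesis by (auto simp: comp_op_def)
  qed
qed

end

theory Submission
  imports Defs
begin

text \<open>Let \<open>h\<^sub>j\<close> be the density of \<open>\<mu> \<circ> \<phi>\<^sup>-\<^sup>j\<close> with respect to \<open>\<mu>\<close>. A class \<open>f\<close> lies in the domain of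
  the \<open>n\<close>-th power iff \<open>\<bar>f\<bar>\<^sup>2h\<^sub>j\<close> is integrable for all \<open>j \<le> n\<close>, so density of the domains forces
  every \<open>h\<^sub>j\<close> to be finite almost everywhere. Conversely, given \<open>f\<close> in the domain of the \<open>n\<close>-th
  power, the measure \<open>\<nu> = \<bar>f\<bar>\<^sup>2(h\<^sub>0 + \<dots> + h\<^sub>n)\<mu>\<close> is finite, so bounds \<open>c\<^sub>j\<close> can be chosen such that
  the set \<open>A\<close> where \<open>h\<^sub>j \<le> c\<^sub>j\<close> for all \<open>j\<close> has complement of small \<open>\<nu>\<close>-measure. Truncating \<open>f\<close>
  to \<open>A\<close> gives a vector in the domain of every power, and the squared distance to \<open>f\<close> in the
  \<open>n\<close>-th graph norm is the \<open>\<nu>\<close>-measure of the complement of \<open>A\<close>.\<close>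

section \<open>Square integrability and representatives of classes\<close>

lemma square_integrable_iff_nn_integral:
  "f \<in> square_integrable M \<longleftrightarrow>
    f \<in> borel_measurable M \<and> (\<integral>\<^sup>+x. ennreal ((cmod (f x))\<^sup>2) \<partial>M) < \<infinity>"
proof -
  have "integrable M (\<lambda>x. (cmod (f x))\<^sup>2) \<longleftrightarrow> (\<integral>\<^sup>+x. ennreal ((cmod (f x))\<^sup>2) \<partial>M) < \<infinity>"
    if "f \<in> borel_measurable M"
    using that by (simp add: integrable_iff_bounded)
  then show ?thesis by (auto simp: square_integrable_def)
qed

lemma square_integrable_diff:
  assumes "f \<in> square_integrable M" "g \<in> square_integrable M"
  shows "(\<lambda>x. f x - g x) \<in> square_integrable M"
  using square_integrable_add[OF assms(1) square_integrable_scale[OF assms(2), of "-1"]] by simp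

lemma ennreal_integral_cmod_square:
  assumes "f \<in> square_integrable M"
  shows "ennreal (\<integral>x. (cmod (f x))\<^sup>2 \<partial>M) = (\<integral>\<^sup>+x. ennreal ((cmod (f x))\<^sup>2) \<partial>M)"
  using assms by (subst nn_integral_eq_integral) (auto simp: square_integrable_def)

lemma in_L2_E:
  assumes "F \<in> L2 M"
  obtains f where "f \<in> square_integrable M" "F = ae_eq M `` {f}"
  using assms by (auto simp: L2_def elim: quotientE)

lemma class_in_L2: "f \<in> square_integrable M \<Longrightarrow> ae_eq M `` {f} \<in> L2 M"
  by (auto simp: L2_def intro: quotientI)

section \<open>Iterates of the transformation and powers of the composition operator\<close>

lemma nonsingular_measurable: "nonsingular M \<phi> \<Longrightarrow> \<phi> \<in> measurable M M"
  by (simp add: nonsingular_def)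

text \<open>By induction, \<open>nonsingular_AE\<close> carries almost everywhere statements along
  each iterate. Absolute continuity is the instance in which the statement is avoidance of a null
  set.\<close>

lemma nonsingular_funpow:
  assumes "nonsingular M \<phi>"
  shows "nonsingular M (\<phi> ^^ n)"
proof -
  have m: "\<phi> ^^ n \<in> measurable M M" for n
    using measurable_compose_n[OF nonsingular_measurable[OF assms]] .
  have ae: "AE x in M. P ((\<phi> ^^ n) x)" if "AE x in M. P x" for P
    using that
  proof (induction n arbitrary: P)
    case (Suc n)
    show ?case using Suc.IH[OF nonsingular_AE[OF assms Suc.prems]] by simp
  qed simp
  have "N \<in> null_sets (distr M M (\<phi> ^^ n))" if N: "N \<in> null_sets M" for N
  proof -
    have "AE x in M. (\<phi> ^^ n) x \<notin> N" by (rule ae[OF AE_not_in[OF N]])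
    with N m show ?thesis
      by (intro null_setsI)
        (auto simp: emeasure_distr AE_iff_null null_sets_def vimage_def Int_def conj_commute)
  qed
  with m show ?thesis by (auto simp: nonsingular_def absolutely_continuous_def)
qed

text \<open>Each application of \<open>comp_op\<close> requires one further composite to be square
  integrable while the earlier requirements persist, hence a condition on all
  \<open>j \<le> n\<close> and not on \<open>n\<close> alone. This turns questions about domains and
  powers into questions about one representative.\<close>

lemma op_power_comp_op_class:
  assumes "nonsingular M \<phi>" "f \<in> square_integrable M"
  shows "op_power (L2 M) (comp_op M \<phi>) n (ae_eq M `` {f}) =
    (if \<forall>j\<le>n. f \<circ> (\<phi> ^^ j) \<in> square_integrable M then Some (ae_eq M `` {f \<circ> (\<phi> ^^ n)}) else None)"
proof (induction n)
  case 0
  then show ?case using assms(2) by (simp add: class_in_L2 comp_def)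
next
  case (Suc n)
  have eq: "f \<circ> (\<phi> ^^ n) \<circ> \<phi> = f \<circ> (\<phi> ^^ Suc n)"
    by (simp only: funpow_Suc_right comp_assoc)
  show ?case
  proof (cases "\<forall>j\<le>n. f \<circ> (\<phi> ^^ j) \<in> square_integrable M")
    case True
    then have "f \<circ> (\<phi> ^^ n) \<in> square_integrable M" by simp
    from comp_op_class[OF assms(1) this] True show ?thesis
      unfolding op_power.simps map_comp_def Suc.IH eq by (auto simp: le_Suc_eq simp del: funpow.simps comp_apply)
  next
    case False
    then have "\<not> (\<forall>j\<le>Suc n. f \<circ> (\<phi> ^^ j) \<in> square_integrable M)"
      by (meson le_SucI)
    with False show ?thesis
      unfolding op_power.simps map_comp_def Suc.IH by (simp only: if_False option.case)
  qed
qed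

lemma dom_op_power_subset_L2: "dom (op_power H A n) \<subseteq> H"
  by (induction n) (auto simp: map_comp_def split: if_splits option.splits)

lemma dom_infinity_subset_dom: "dom_infinity H A \<subseteq> dom (op_power H A n)"
  by (auto simp: dom_infinity_def)

lemma class_in_dom_op_power:
  assumes "nonsingular M \<phi>" "f \<in> square_integrable M"
  shows "ae_eq M `` {f} \<in> dom (op_power (L2 M) (comp_op M \<phi>) n) \<longleftrightarrow>
    (\<forall>j\<le>n. f \<circ> (\<phi> ^^ j) \<in> square_integrable M)"
  using op_power_comp_op_class[OF assms, of n] by (auto simp: dom_def)

lemma class_in_dom_infinity:
  assumes "nonsingular M \<phi>" "f \<in> square_integrable M"
  shows "ae_eq M `` {f} \<in> dom_infinity (L2 M) (comp_op M \<phi>) \<longleftrightarrow>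
    (\<forall>j. f \<circ> (\<phi> ^^ j) \<in> square_integrable M)"
  unfolding dom_infinity_def using class_in_dom_op_power[OF assms] by auto

lemma l2_subspace_dom_infinity:
  assumes ns: "nonsingular M \<phi>"
  shows "l2_subspace M (dom_infinity (L2 M) (comp_op M \<phi>))"
  unfolding l2_subspace_def
proof (intro conjI ballI allI)
  let ?D = "dom_infinity (L2 M) (comp_op M \<phi>)"
  show sub: "?D \<subseteq> L2 M"
    using dom_infinity_subset_dom dom_op_power_subset_L2 by (rule subset_trans)
  have z: "(\<lambda>x. 0) \<in> square_integrable M" by (simp add: square_integrable_def)
  show "l2_zero M \<in> ?D"
    using z by (simp add: l2_zero_def class_in_dom_infinity[OF ns z] comp_def)
  fix F assume F: "F \<in> ?D"
  with sub obtain f where f: "f \<in> square_integrable M" "F = ae_eq M `` {f}"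
    by (blast elim: in_L2_E)
  have fj: "f \<circ> (\<phi> ^^ j) \<in> square_integrable M" for j
    using F by (auto simp: f(2) class_in_dom_infinity[OF ns f(1)])
  show "l2_scale M c F \<in> ?D" for c
    using square_integrable_scale[OF fj, of c]
    by (simp add: f l2_scale_class class_in_dom_infinity[OF ns square_integrable_scale] comp_def)
  fix G assume G: "G \<in> ?D"
  with sub obtain g where g: "g \<in> square_integrable M" "G = ae_eq M `` {g}"
    by (blast elim: in_L2_E)
  have gj: "g \<circ> (\<phi> ^^ j) \<in> square_integrable M" for j
    using G by (auto simp: g(2) class_in_dom_infinity[OF ns g(1)])
  show "l2_add M F G \<in> ?D"
    using square_integrable_add[OF fj gj]
    by (simp add: f g l2_add_class class_in_dom_infinity[OF ns square_integrable_add] comp_def)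
qed

text \<open>The assumptions for all \<open>j \<le> n\<close> put the difference into the domain of
  each power that occurs, so every \<open>the\<close> in the norm meets a
  \<open>Some\<close>.\<close>

lemma power_graph_norm_diff_class:
  assumes ns: "nonsingular M \<phi>"
    and f: "\<And>j. j \<le> n \<Longrightarrow> f \<circ> (\<phi> ^^ j) \<in> square_integrable M"
    and g: "\<And>j. j \<le> n \<Longrightarrow> g \<circ> (\<phi> ^^ j) \<in> square_integrable M"
  shows "power_graph_norm M (comp_op M \<phi>) n (l2_diff M (ae_eq M `` {f}) (ae_eq M `` {g})) =
    sqrt (\<Sum>j\<le>n. \<integral>x. (cmod (f ((\<phi> ^^ j) x) - g ((\<phi> ^^ j) x)))\<^sup>2 \<partial>M)"
proof -
  have f0: "f \<in> square_integrable M" and g0: "g \<in> square_integrable M"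
    using f[of 0] g[of 0] by (auto simp: comp_def)
  let ?d = "\<lambda>x. f x - g x"
  have d: "?d \<circ> (\<phi> ^^ j) \<in> square_integrable M" if "j \<le> n" for j
    using square_integrable_diff[OF f[OF that] g[OF that]] by (simp add: comp_def)
  have d0: "?d \<in> square_integrable M" by (rule square_integrable_diff[OF f0 g0])
  have "l2_norm M (the (op_power (L2 M) (comp_op M \<phi>) j (ae_eq M `` {?d}))) =
      sqrt (\<integral>x. (cmod (f ((\<phi> ^^ j) x) - g ((\<phi> ^^ j) x)))\<^sup>2 \<partial>M)" if j: "j \<le> n" for j
  proof -
    have "\<forall>i\<le>j. ?d \<circ> (\<phi> ^^ i) \<in> square_integrable M" using d j by auto
    then show ?thesis
      using l2_norm_class[OF d[OF j]] by (simp add: op_power_comp_op_class[OF ns d0] comp_def)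
  qed
  then have "(l2_norm M (the (op_power (L2 M) (comp_op M \<phi>) j (ae_eq M `` {?d}))))\<^sup>2 =
      (\<integral>x. (cmod (f ((\<phi> ^^ j) x) - g ((\<phi> ^^ j) x)))\<^sup>2 \<partial>M)" if "j \<le> n" for j
    using that by simp
  then show ?thesis
    by (simp add: power_graph_norm_def l2_diff_class[OF f0 g0])
qed

section \<open>Densities of the pushforward measures and their finiteness\<close>

lemma nn_integral_comp_density:
  assumes h: "h \<in> borel_measurable M" "density M h = distr M M \<psi>"
    and \<psi>: "\<psi> \<in> measurable M M" and u: "u \<in> borel_measurable M"
  shows "(\<integral>\<^sup>+x. u (\<psi> x) \<partial>M) = (\<integral>\<^sup>+x. h x * u x \<partial>M)"
proof -
  have "(\<integral>\<^sup>+x. u (\<psi> x) \<partial>M) = (\<integral>\<^sup>+x. u x \<partial>distr M M \<psi>)"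
    using \<psi> u by (simp add: nn_integral_distr)
  also have "\<dots> = (\<integral>\<^sup>+x. h x * u x \<partial>M)"
    using h u by (simp add: h(2)[symmetric] nn_integral_density)
  finally show ?thesis .
qed

text \<open>Radon-Nikodym applies since \<open>M\<close> is sigma-finite. The pushforward itself
  need not be, so \<open>h j\<close> may take the value infinity on a set of positive
  measure.\<close>

lemma (in sigma_finite_measure) ex_density_funpow:
  assumes "nonsingular M \<phi>"
  obtains h :: "nat \<Rightarrow> 'a \<Rightarrow> ennreal"
  where "\<And>j. h j \<in> borel_measurable M" "\<And>j. density M (h j) = distr M M (\<phi> ^^ j)"
proof -
  have "\<exists>h\<in>borel_measurable M. density M h = distr M M (\<phi> ^^ j)" for j
    using nonsingular_funpow[OF assms, of j] by (intro Radon_Nikodym) (auto simp: nonsingular_def)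
  then show ?thesis using that by metis
qed

text \<open>A vector of \<open>D\<close> must vanish almost everywhere on the set where
  \<open>h\<close> is infinite. If that set had positive measure, the indicator of a part of it
  could not be approximated from \<open>D\<close>.\<close>

lemma (in sigma_finite_measure) density_finite_AE:
  assumes h: "h \<in> borel_measurable M" "density M h = distr M M \<psi>"
    and \<psi>: "\<psi> \<in> measurable M M"
    and dense: "l2_dense M (l2_norm M) D (L2 M)"
    and D: "\<And>f. f \<in> square_integrable M \<Longrightarrow> ae_eq M `` {f} \<in> D \<Longrightarrow> f \<circ> \<psi> \<in> square_integrable M"
  shows "AE x in M. h x < \<infinity>"
proof (rule ccontr)
  assume not_AE: "\<not> (AE x in M. h x < \<infinity>)"
  note [measurable] = h(1)
  define B where "B = {x \<in> space M. h x = \<infinity>}"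
  have B: "B \<in> sets M" unfolding B_def by measurable
  have "emeasure M B \<noteq> 0"
    using not_AE AE_iff_measurable[OF B, of "\<lambda>x. h x < \<infinity>"]
    by (auto simp: B_def less_top[symmetric])
  \<comment> \<open>The indicator of \<open>B\<close> may fail to be square integrable; if
    \<open>B\<close> has infinite measure, sigma-finiteness supplies a subset of finite positive
    measure.\<close>
  then obtain S where S: "S \<in> sets M" "S \<subseteq> B" "0 < emeasure M S" "emeasure M S < \<infinity>"
  proof (cases "emeasure M B = \<infinity>")
    case True
    then obtain S where "S \<in> sets M" "S \<subseteq> B" "emeasure M S < \<infinity>" "emeasure M S > ennreal 1"
      using approx_PInf_emeasure_with_finite[OF B, of 1] by blast
    moreover from this(4) have "0 < emeasure M S" by (rule le_less_trans[rotated]) simp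
    ultimately show ?thesis using that by blast
  next
    case False
    then show ?thesis using that[OF B] \<open>emeasure M B \<noteq> 0\<close> by (auto simp: less_top zero_less_iff_neq_zero)
  qed
  note [measurable] = S(1)
  define u :: "'a \<Rightarrow> complex" where "u = indicator S"
  have cmod_u: "ennreal ((cmod (u x))\<^sup>2) = indicator S x" for x
    by (simp add: u_def indicator_def)
  have u: "u \<in> square_integrable M"
    unfolding square_integrable_iff_nn_integral cmod_u using S by (simp add: u_def)
  have m: "measure M S > 0"
    using S by (simp add: measure_def enn2real_positive_iff)
  \<comment> \<open>The radius is the norm of \<open>u\<close>, the distance from \<open>u\<close>
    to any function vanishing on \<open>S\<close> being at least that.\<close>
  obtain G where G: "G \<in> D" "l2_norm M (l2_diff M (ae_eq M `` {u}) G) < sqrt (measure M S)"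
    using dense class_in_L2[OF u] m unfolding l2_dense_def by (meson real_sqrt_gt_zero)
  moreover have "G \<in> L2 M" using G(1) dense by (auto simp: l2_dense_def)
  ultimately obtain g where g: "g \<in> square_integrable M" "G = ae_eq M `` {g}"
    by (blast elim: in_L2_E)
  have [measurable]: "g \<in> borel_measurable M" using g by (simp add: square_integrable_def)
  have d: "(\<lambda>x. u x - g x) \<in> square_integrable M" by (rule square_integrable_diff[OF u g(1)])
  have "(\<integral>x. (cmod (u x - g x))\<^sup>2 \<partial>M) < measure M S"
    using G(2) by (simp add: g l2_diff_class[OF u g(1)] l2_norm_class[OF d])
  then have lt: "(\<integral>\<^sup>+x. ennreal ((cmod (u x - g x))\<^sup>2) \<partial>M) < emeasure M S"
    using S(4) ennreal_integral_cmod_square[OF d, symmetric]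
    by (simp add: emeasure_eq_ennreal_measure less_top ennreal_less_iff)
  have "g \<circ> \<psi> \<in> square_integrable M" using D g G(1) by simp
  then have "(\<integral>\<^sup>+x. h x * ennreal ((cmod (g x))\<^sup>2) \<partial>M) < \<infinity>"
    using nn_integral_comp_density[OF h \<psi>, of "\<lambda>x. ennreal ((cmod (g x))\<^sup>2)"]
    by (simp add: square_integrable_iff_nn_integral)
  \<comment> \<open>On \<open>S\<close> the factor \<open>h x\<close> is infinite, so finiteness of
    the product forces \<open>g x = 0\<close> and hence \<open>\<bar>u x - g x\<bar> = 1\<close>
    there.\<close>
  then have "AE x in M. h x * ennreal ((cmod (g x))\<^sup>2) \<noteq> \<infinity>"
    by (intro nn_integral_PInf_AE) auto
  then have "AE x in M. indicator S x \<le> ennreal ((cmod (u x - g x))\<^sup>2)"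
  proof eventually_elim
    case (elim x)
    show ?case
    proof (cases "x \<in> S")
      case True
      then have "h x = \<infinity>" using S(2) by (auto simp: B_def)
      with elim have "g x = 0" by (auto simp: ennreal_top_mult split: if_splits)
      then show ?thesis using True by (simp add: u_def)
    qed simp
  qed
  then have "emeasure M S \<le> (\<integral>\<^sup>+x. ennreal ((cmod (u x - g x))\<^sup>2) \<partial>M)"
    using nn_integral_mono_AE[of "indicator S" "\<lambda>x. ennreal ((cmod (u x - g x))\<^sup>2)" M] by simp
  with lt show False by simp
qed

text \<open>For fixed \<open>j\<close> the sets where \<open>h j\<close> exceeds \<open>k\<close>
  decrease to a null set, so a finite measure makes them small. Geometric weights then handle all
  \<open>j\<close> at once.\<close>

lemma (in finite_measure) ex_bounds_small_complement:
  fixes h :: "nat \<Rightarrow> 'a \<Rightarrow> ennreal"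
  assumes h[measurable]: "\<And>j. h j \<in> borel_measurable M"
    and fin: "\<And>j. AE x in M. h j x < \<infinity>" and "0 < e"
  obtains c :: "nat \<Rightarrow> nat" where "measure M {x \<in> space M. \<exists>j. of_nat (c j) < h j x} < e"
proof -
  \<comment> \<open>The weights sum to \<open>e/2\<close> rather than \<open>e\<close>: passing to
    the infinite sum leaves only a non-strict inequality, and the spare half restores
    strictness.\<close>
  have "\<exists>k::nat. measure M {x \<in> space M. of_nat k < h j x} < e/2 * (1/2)^Suc j" for j
  proof -
    let ?A = "\<lambda>k::nat. {x \<in> space M. of_nat k < h j x}"
    have "(\<lambda>k. measure M (?A k)) \<longlonglongrightarrow> measure M (\<Inter>k. ?A k)"
    proof (rule finite_Lim_measure_decseq)
      show "range ?A \<subseteq> sets M" by auto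
      show "decseq ?A"
        by (rule decseq_SucI) (auto intro: le_less_trans[rotated])
    qed
    moreover have "measure M (\<Inter>k. ?A k) = 0"
    proof -
      have "AE x in M. x \<notin> (\<Inter>k. ?A k)"
        using fin[of j]
      proof eventually_elim
        case (elim x)
        then obtain k :: nat where "h j x < of_nat k"
          using ennreal_Ex_less_of_nat by auto
        then show ?case by (auto simp: not_less intro!: exI[of _ k] less_imp_le)
      qed
      moreover have "(\<Inter>k. ?A k) \<in> sets M" by measurable
      ultimately have "emeasure M (\<Inter>k. ?A k) = 0"
        by (subst AE_iff_measurable[symmetric, where P = "\<lambda>x. x \<notin> (\<Inter>k. ?A k)"]) auto
      then show ?thesis by (simp add: measure_def)
    qed
    ultimately have "(\<lambda>k. measure M (?A k)) \<longlonglongrightarrow> 0" by simp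
    from order_tendstoD(2)[OF this, of "e/2 * (1/2)^Suc j"] \<open>0 < e\<close> show ?thesis
      by (auto simp: eventually_sequentially)
  qed
  then obtain c :: "nat \<Rightarrow> nat"
    where c: "\<And>j. measure M {x \<in> space M. of_nat (c j) < h j x} < e/2 * (1/2)^Suc j"
    by metis
  let ?B = "\<lambda>j. {x \<in> space M. of_nat (c j) < h j x}"
  have s: "(\<lambda>j. e/2 * (1/2)^Suc j) sums (e/2)"
    using sums_mult[OF power_half_series, of "e/2"] by simp
  have sB: "summable (\<lambda>j. measure M (?B j))"
    by (rule summable_comparison_test'[OF sums_summable[OF s], of 0]) (use c in \<open>auto intro: less_imp_le\<close>)
  have "measure M (\<Union>j. ?B j) \<le> (\<Sum>j. measure M (?B j))"
    by (rule finite_measure_subadditive_countably[OF _ sB]) auto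
  also have "\<dots> \<le> (\<Sum>j. e/2 * (1/2)^Suc j)"
    by (rule suminf_le[OF less_imp_le[OF c] sB sums_summable[OF s]])
  also have "\<dots> < e" using sums_unique[OF s] \<open>0 < e\<close> by simp
  also have "(\<Union>j. ?B j) = {x \<in> space M. \<exists>j. of_nat (c j) < h j x}" by auto
  finally show ?thesis by (rule that)
qed

section \<open>Approximation by truncation, and comparison of norms\<close>

lemma (in sigma_finite_measure) dom_infinity_dense_dom_op_power:
  assumes ns: "nonsingular M \<phi>"
    and h: "\<And>j. h j \<in> borel_measurable M" "\<And>j. density M (h j) = distr M M (\<phi> ^^ j)"
    and fin: "\<And>j. AE x in M. h j x < \<infinity>"
  shows "l2_dense M (power_graph_norm M (comp_op M \<phi>) n)
    (dom_infinity (L2 M) (comp_op M \<phi>)) (dom (op_power (L2 M) (comp_op M \<phi>) n))"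
  unfolding l2_dense_def
proof (intro conjI ballI allI impI)
  let ?C = "comp_op M \<phi>"
  show "dom_infinity (L2 M) ?C \<subseteq> dom (op_power (L2 M) ?C n)"
    by (rule dom_infinity_subset_dom)
  fix F and e :: real assume F: "F \<in> dom (op_power (L2 M) ?C n)" and e: "0 < e"
  obtain f where f0: "f \<in> square_integrable M" and Ff: "F = ae_eq M `` {f}"
    using subsetD[OF dom_op_power_subset_L2 F] by (rule in_L2_E)
  have f: "f \<circ> (\<phi> ^^ j) \<in> square_integrable M" if "j \<le> n" for j
    using F that by (simp add: Ff class_in_dom_op_power[OF ns f0])
  note [measurable] = h(1) and
    m[measurable] = nonsingular_measurable[OF nonsingular_funpow[OF ns]]
  have [measurable]: "f \<in> borel_measurable M" using f0 by (simp add: square_integrable_def)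
  define w where "w x = (\<Sum>j\<le>n. h j x * ennreal ((cmod (f x))\<^sup>2))" for x
  have [measurable]: "w \<in> borel_measurable M" unfolding w_def by measurable
  define \<nu> where "\<nu> = density M w"
  have sp: "space \<nu> = space M" and st[measurable_cong]: "sets \<nu> = sets M" by (simp_all add: \<nu>_def)
  \<comment> \<open>The right side is the squared \<open>n\<close>-th graph norm of the restriction
    of \<open>f\<close> to \<open>S\<close>. With \<open>S = space M\<close> it shows that
    \<open>\<nu>\<close> is finite; with \<open>S = B\<close> it is the squared error of the
    truncation.\<close>
  have \<nu>_eq: "emeasure \<nu> S =
      (\<Sum>j\<le>n. \<integral>\<^sup>+x. ennreal ((cmod (indicator S ((\<phi> ^^ j) x) * f ((\<phi> ^^ j) x)))\<^sup>2) \<partial>M)"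
    if S[measurable]: "S \<in> sets M" for S
  proof -
    have "emeasure \<nu> S = (\<integral>\<^sup>+x. w x * indicator S x \<partial>M)"
      by (simp add: \<nu>_def emeasure_density)
    also have "\<dots> = (\<integral>\<^sup>+x. (\<Sum>j\<le>n. h j x * ennreal ((cmod (indicator S x * f x))\<^sup>2)) \<partial>M)"
      by (intro nn_integral_cong) (auto simp: w_def indicator_def)
    also have "\<dots> = (\<Sum>j\<le>n. \<integral>\<^sup>+x. h j x * ennreal ((cmod (indicator S x * f x))\<^sup>2) \<partial>M)"
      by (rule nn_integral_sum) measurable
    also have "\<dots> = (\<Sum>j\<le>n. \<integral>\<^sup>+x. ennreal ((cmod (indicator S ((\<phi> ^^ j) x) * f ((\<phi> ^^ j) x)))\<^sup>2) \<partial>M)"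
      by (subst nn_integral_comp_density[OF h m, of
            "\<lambda>x. ennreal ((cmod (indicator S x * f x))\<^sup>2)"]) simp_all
    finally show ?thesis .
  qed
  have "emeasure \<nu> (space M) \<noteq> \<infinity>"
  proof -
    have "(\<integral>\<^sup>+x. ennreal ((cmod (indicator (space M) ((\<phi> ^^ j) x) * f ((\<phi> ^^ j) x)))\<^sup>2) \<partial>M) < \<infinity>"
      if "j \<le> n" for j
    proof -
      have "(\<integral>\<^sup>+x. ennreal ((cmod (indicator (space M) ((\<phi> ^^ j) x) * f ((\<phi> ^^ j) x)))\<^sup>2) \<partial>M) =
        (\<integral>\<^sup>+x. ennreal ((cmod ((f \<circ> (\<phi> ^^ j)) x))\<^sup>2) \<partial>M)"
        by (intro nn_integral_cong) (use measurable_space[OF m] in auto)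
      then show ?thesis using f[OF that] by (simp add: square_integrable_iff_nn_integral)
    qed
    then show ?thesis by (simp add: \<nu>_eq less_top)
  qed
  then interpret \<nu>: finite_measure \<nu> by (intro finite_measureI) (simp add: sp)
  \<comment> \<open>Null sets of \<open>M\<close> are null for \<open>\<nu>\<close>, which has a
    density with respect to \<open>M\<close>.\<close>
  have "AE x in \<nu>. h j x < \<infinity>" for j
    unfolding \<nu>_def by (subst AE_density) (use fin[of j] in auto)
  \<comment> \<open>All \<open>j\<close> are bounded here, also those beyond \<open>n\<close>: this
    places the truncation in the domain of every power, although the error involves only
    \<open>j \<le> n\<close>.\<close>
  then obtain c :: "nat \<Rightarrow> nat"
    where c: "measure \<nu> {x \<in> space \<nu>. \<exists>j. of_nat (c j) < h j x} < e\<^sup>2"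
    using \<nu>.ex_bounds_small_complement[of h "e\<^sup>2"] e by (auto simp: measurable_cong_sets[OF st refl])
  define A where "A = {x \<in> space M. \<forall>j. h j x \<le> of_nat (c j)}"
  define B where "B = {x \<in> space M. \<exists>j. of_nat (c j) < h j x}"
  have [measurable]: "A \<in> sets M" "B \<in> sets M" unfolding A_def B_def by measurable
  define g where "g x = indicator A x * f x" for x
  have [measurable]: "g \<in> borel_measurable M" unfolding g_def by measurable
  have gj: "g \<circ> (\<phi> ^^ j) \<in> square_integrable M" for j
  proof -
    have "(\<integral>\<^sup>+x. ennreal ((cmod ((g \<circ> (\<phi> ^^ j)) x))\<^sup>2) \<partial>M) =
        (\<integral>\<^sup>+x. h j x * ennreal ((cmod (g x))\<^sup>2) \<partial>M)"
      using nn_integral_comp_density[OF h m, of "\<lambda>x. ennreal ((cmod (g x))\<^sup>2)" j] by simp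
    \<comment> \<open>Where \<open>g\<close> is nonzero, \<open>x\<close> lies in \<open>A\<close>
      and \<open>h j x\<close> is at most \<open>c j\<close>; so only square integrability of
      \<open>f\<close> itself is needed, for every \<open>j\<close>.\<close>
    also have "\<dots> \<le> (\<integral>\<^sup>+x. of_nat (c j) * ennreal ((cmod (f x))\<^sup>2) \<partial>M)"
      by (intro nn_integral_mono) (auto simp: g_def A_def indicator_def intro: mult_right_mono)
    also have "\<dots> = of_nat (c j) * (\<integral>\<^sup>+x. ennreal ((cmod (f x))\<^sup>2) \<partial>M)"
      by (rule nn_integral_cmult) measurable
    also have "\<dots> < \<infinity>"
      using f0 by (auto simp: square_integrable_iff_nn_integral ennreal_mult_less_top of_nat_less_top)
    finally show ?thesis by (simp add: square_integrable_iff_nn_integral)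
  qed
  have g0: "g \<in> square_integrable M" using gj[of 0] by (simp add: comp_def)
  have fg: "f y - g y = indicator B y * f y" if "y \<in> space M" for y
    using that by (auto simp: g_def A_def B_def indicator_def not_less[symmetric])
  have "ennreal (\<Sum>j\<le>n. \<integral>x. (cmod (f ((\<phi> ^^ j) x) - g ((\<phi> ^^ j) x)))\<^sup>2 \<partial>M) =
      (\<Sum>j\<le>n. ennreal (\<integral>x. (cmod (f ((\<phi> ^^ j) x) - g ((\<phi> ^^ j) x)))\<^sup>2 \<partial>M))"
    by (simp add: sum_ennreal)
  also have "\<dots> = (\<Sum>j\<le>n. \<integral>\<^sup>+x. ennreal ((cmod (f ((\<phi> ^^ j) x) - g ((\<phi> ^^ j) x)))\<^sup>2) \<partial>M)"
    using ennreal_integral_cmod_square[OF square_integrable_diff[OF f gj]] by simp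
  also have "\<dots> = emeasure \<nu> B"
    unfolding \<nu>_eq[OF \<open>B \<in> sets M\<close>]
    by (intro sum.cong refl nn_integral_cong) (use fg measurable_space[OF m] in auto)
  also have "\<dots> < ennreal (e\<^sup>2)"
    using c by (simp add: \<nu>.emeasure_eq_measure B_def sp ennreal_less_iff)
  finally have "(\<Sum>j\<le>n. \<integral>x. (cmod (f ((\<phi> ^^ j) x) - g ((\<phi> ^^ j) x)))\<^sup>2 \<partial>M) < e\<^sup>2"
    by (simp add: ennreal_less_iff sum_nonneg)
  then have "power_graph_norm M ?C n (l2_diff M F (ae_eq M `` {g})) < e"
    using power_graph_norm_diff_class[OF ns f gj, of n] e
    by (simp add: Ff real_less_lsqrt sum_nonneg)
  moreover have "ae_eq M `` {g} \<in> dom_infinity (L2 M) ?C"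
    using gj by (simp add: class_in_dom_infinity[OF ns g0])
  ultimately show "\<exists>G\<in>dom_infinity (L2 M) ?C. power_graph_norm M ?C n (l2_diff M F G) < e"
    by blast
qed

lemma l2_diff_in_L2: "F \<in> L2 M \<Longrightarrow> G \<in> L2 M \<Longrightarrow> l2_diff M F G \<in> L2 M"
  by (auto elim!: in_L2_E simp: l2_diff_class intro!: class_in_L2 square_integrable_diff)

text \<open>Serves three implications of the final theorem: two replace the norm by a dominated one,
  the third enlarges the dense set.\<close>

lemma l2_dense_mono:
  assumes "l2_dense M N E D" "E \<subseteq> E'" "E' \<subseteq> D" "0 < c"
    and "\<And>F G. F \<in> D \<Longrightarrow> G \<in> E \<Longrightarrow> N' (l2_diff M F G) \<le> c * N (l2_diff M F G)"
  shows "l2_dense M N' E' D"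
  unfolding l2_dense_def
proof (intro conjI ballI allI impI)
  fix F and e :: real assume F: "F \<in> D" and "0 < e"
  then have "0 < e / c" using assms(4) by simp
  then obtain G where G: "G \<in> E" "N (l2_diff M F G) < e / c"
    using assms(1) F unfolding l2_dense_def by blast
  then have "N' (l2_diff M F G) < e"
    using assms(5)[OF F G(1)] assms(4) by (simp add: field_simps)
  with G(1) assms(2) show "\<exists>G\<in>E'. N' (l2_diff M F G) < e" by blast
qed (rule assms(3))

lemma graph_norm_le_power_graph_norm:
  assumes "F \<in> L2 M"
  shows "graph_norm M (op_power (L2 M) A n) F \<le> sqrt 2 * power_graph_norm M A n F"
proof -
  let ?t = "\<lambda>j. (l2_norm M (the (op_power (L2 M) A j F)))\<^sup>2"
  have le: "?t j \<le> (\<Sum>j\<le>n. ?t j)" if "j \<le> n" for j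
    using that by (intro member_le_sum) auto
  \<comment> \<open>The factor 2 covers \<open>n = 0\<close>, where both summands on the left are
    the same single term of the sum.\<close>
  have "(l2_norm M F)\<^sup>2 + ?t n \<le> 2 * (\<Sum>j\<le>n. ?t j)"
    using le[of 0] le[of n] assms by simp
  then show ?thesis
    unfolding graph_norm_def power_graph_norm_def real_sqrt_mult[symmetric] by simp
qed

theorem theorem4p7:
  fixes M :: "'a measure" and \<phi> :: "'a \<Rightarrow> 'a"
  assumes "sigma_finite_measure M"
    and "nonsingular M \<phi>"
  shows
    "((\<forall>n\<ge>1. l2_dense M (l2_norm M) (dom (op_power (L2 M) (comp_op M \<phi>) n)) (L2 M))
      \<longleftrightarrow> l2_dense M (l2_norm M) (dom_infinity (L2 M) (comp_op M \<phi>)) (L2 M))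
   \<and> (l2_dense M (l2_norm M) (dom_infinity (L2 M) (comp_op M \<phi>)) (L2 M)
      \<longleftrightarrow> (\<forall>n. is_core M (op_power (L2 M) (comp_op M \<phi>) n) (dom_infinity (L2 M) (comp_op M \<phi>))))
   \<and> ((\<forall>n. is_core M (op_power (L2 M) (comp_op M \<phi>) n) (dom_infinity (L2 M) (comp_op M \<phi>)))
      \<longleftrightarrow> (\<forall>n. l2_dense M (power_graph_norm M (comp_op M \<phi>) n)
                (dom_infinity (L2 M) (comp_op M \<phi>))
                (dom (op_power (L2 M) (comp_op M \<phi>) n))))"
proof -
  interpret sigma_finite_measure M by (rule assms(1))
  note ns = assms(2)
  let ?C = "comp_op M \<phi>"
  let ?D = "\<lambda>n. dom (op_power (L2 M) ?C n)" and ?E = "dom_infinity (L2 M) ?C"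
  let ?i = "\<forall>n\<ge>1. l2_dense M (l2_norm M) (?D n) (L2 M)"
  let ?ii = "l2_dense M (l2_norm M) ?E (L2 M)"
  let ?iii = "\<forall>n. is_core M (op_power (L2 M) ?C n) ?E"
  let ?iv = "\<forall>n. l2_dense M (power_graph_norm M ?C n) ?E (?D n)"
  \<comment> \<open>The implications are proved in the cycle (i), (iv), (iii), (ii), (i).\<close>
  have "?iv" if i: "?i"
  proof -
    obtain h where h: "\<And>j. h j \<in> borel_measurable M" "\<And>j. density M (h j) = distr M M (\<phi> ^^ j)"
      using ex_density_funpow[OF ns] by blast
    have "AE x in M. h j x < \<infinity>" for j
    proof (rule density_finite_AE[OF h])
      show "\<phi> ^^ j \<in> measurable M M"
        by (rule nonsingular_measurable[OF nonsingular_funpow[OF ns]])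
      \<comment> \<open>Condition (i) starts at exponent 1, so \<open>Suc j\<close> is taken to
        include \<open>j = 0\<close>; its domain still controls the composite with the
        \<open>j\<close>-th iterate.\<close>
      show "l2_dense M (l2_norm M) (?D (Suc j)) (L2 M)" by (rule i[rule_format]) simp
      show "f \<circ> (\<phi> ^^ j) \<in> square_integrable M"
        if "f \<in> square_integrable M" "ae_eq M `` {f} \<in> ?D (Suc j)" for f
        using that class_in_dom_op_power[OF ns] le_SucI by blast
    qed
    then show ?thesis using dom_infinity_dense_dom_op_power[OF ns h] by blast
  qed
  moreover have "?iii" if iv: "?iv"
    unfolding is_core_def
  proof (intro allI conjI)
    fix n
    show "l2_subspace M ?E" by (rule l2_subspace_dom_infinity[OF ns])
    show sub: "?E \<subseteq> ?D n" by (rule dom_infinity_subset_dom)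
    show "l2_dense M (graph_norm M (op_power (L2 M) ?C n)) ?E (?D n)"
    proof (rule l2_dense_mono[OF iv[rule_format] subset_refl sub])
      fix F G assume "F \<in> ?D n" "G \<in> ?E"
      then have "F \<in> L2 M" "G \<in> L2 M"
        using subsetD[OF dom_op_power_subset_L2] subsetD[OF sub] by metis+
      then show "graph_norm M (op_power (L2 M) ?C n) (l2_diff M F G) \<le>
          sqrt 2 * power_graph_norm M ?C n (l2_diff M F G)"
        by (intro graph_norm_le_power_graph_norm l2_diff_in_L2)
    qed simp
  qed
  moreover have "?ii" if "?iii"
  proof -
    \<comment> \<open>The core condition at \<open>n = 0\<close> already yields (ii): the zeroth
      power is the identity on \<open>L2 M\<close>, and its graph norm dominates the norm.\<close>
    have D0: "?D 0 = L2 M" by (auto split: if_splits)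
    have "l2_dense M (graph_norm M (op_power (L2 M) ?C 0)) ?E (?D 0)"
      using that unfolding is_core_def by blast
    then have dense: "l2_dense M (graph_norm M (op_power (L2 M) ?C 0)) ?E (L2 M)"
      unfolding D0 .
    show ?thesis
    proof (rule l2_dense_mono[OF dense subset_refl])
      show "?E \<subseteq> L2 M" using dense by (simp add: l2_dense_def)
      show "l2_norm M (l2_diff M F G) \<le> 1 * graph_norm M (op_power (L2 M) ?C 0) (l2_diff M F G)" for F G
        by (auto simp: graph_norm_def intro!: real_le_rsqrt)
    qed simp
  qed
  moreover have "?i" if "?ii"
  proof (intro allI impI)
    fix n
    show "l2_dense M (l2_norm M) (?D n) (L2 M)"
      by (rule l2_dense_mono[OF that dom_infinity_subset_dom dom_op_power_subset_L2, of 1]) auto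
  qed
  ultimately show ?thesis by argo
qed

end
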